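(* Let $(P_1,\cdot_1,\{~,~\}_1)$ be a Poisson algebra (over a field of characteristic $0$) that acts on another Poisson algebra $(P_2,\cdot_2,\{~,~\}_2)$ by the maps $\mu,\rho:P_1\to\mathrm{End}(P_2)$. A linear map $D:P_1\to P_2$ is a relative crossed homomorphism if and only if its graph $Gr(D)=\{(D(x),x)\mid x\in P_1\}$ is a Poisson subalgebra of the proto-twilled Poisson algebra $(P_2\oplus P_1,\cdot_\rtimes,\{~,~\}_\rtimes)$.
   Context: A Poisson algebra is a vector space with a commutative associative product and a Lie bracket such that the bracket satisfies the Leibniz rule $\{x,yz\}=\{x,y\}z+y\{x,z\}$; a Poisson subalgebra is a subspace closed under both operations. A proto-twilled Poisson algebra is a Poisson algebra whose underlying vector space is given with a direct sum decomposition into two subspaces. An action of $(P_1,\cdot_1,\{~,~\}_1)$ on $(P_2,\cdot_2,\{~,~\}_2)$ is given by linear maps $\mu,\rho:P_1\to\mathrm{End}(P_2)$ such that $(P_2,\mu,\rho)$ is a representation of $P_1$ (that is $\mu_{x\cdot_1y}=\mu_x\mu_y$, $\rho_{\{x,y\}_1}=\rho_x\rho_y-\rho_y\rho_x$, $\mu_{\{x,y\}_1}=\rho_x\mu_y-\mu_y\rho_x$, $\rho_{x\cdot_1y}=\mu_x\rho_y+\mu_y\rho_x$) and for all $x\in P_1$, $u,v\in P_2$: $\mu_x(u\cdot_2v)=\mu_x(u)\cdot_2v$, $\mu_x\{u,v\}_2=\{\mu_xu,v\}_2-u\cdot_2\rho_xv$, $\rho_x(u\cdot_2v)=\rho_x(u)\cdot_2v+u\cdot_2\rho_x(v)$,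 $\rho_x\{u,v\}_2=\{\rho_xu,v\}_2+\{u,\rho_xv\}_2$. Then $P_2\oplus P_1$ is a Poisson algebra with $(u,x)\cdot_\rtimes(v,y)=(u\cdot_2v+\mu_xv+\mu_yu,\ x\cdot_1y)$ and $\{(u,x),(v,y)\}_\rtimes=(\{u,v\}_2+\rho_xv-\rho_yu,\ \{x,y\}_1)$. A linear map $D:P_1\to P_2$ is a relative crossed homomorphism (on $P_1$ with values in $P_2$) if for all $x,y\in P_1$: $D(x\cdot_1y)=\mu_xD(y)+\mu_yD(x)+D(x)\cdot_2D(y)$ and $D(\{x,y\}_1)=\rho_xD(y)-\rho_yD(x)+\{D(x),D(y)\}_2$. *)

theory Defs
  imports "HOL-Analysis.Product_Vector"
begin

definition bilinear_over ::
  "('k::field \<Rightarrow> 'a::ab_group_add \<Rightarrow> 'a) \<Rightarrow> ('k \<Rightarrow> 'b::ab_group_add \<Rightarrow> 'b) \<Rightarrow>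
    ('k \<Rightarrow> 'c::ab_group_add \<Rightarrow> 'c) \<Rightarrow> ('a \<Rightarrow> 'b \<Rightarrow> 'c) \<Rightarrow> bool"
  where "bilinear_over s1 s2 s3 f \<longleftrightarrow>
    (\<forall>x. Vector_Spaces.linear s2 s3 (\<lambda>y. f x y)) \<and> (\<forall>y. Vector_Spaces.linear s1 s3 (\<lambda>x. f x y))"

lemma bilinear_overI:
  assumes "vector_space s1" "vector_space s2" "vector_space s3"
    and "\<And>x y y'. f x (y + y') = f x y + f x y'"
    and "\<And>x c y. f x (s2 c y) = s3 c (f x y)"
    and "\<And>x x' y. f (x + x') y = f x y + f x' y"
    and "\<And>x c y. f (s1 c x) y = s3 c (f x y)"
  shows "bilinear_over s1 s2 s3 f"
  using assms
  by (auto simp: bilinear_over_def Vector_Spaces.linear_def module_hom_def module_hom_axioms_def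
      vector_space_def module_def)

lemma
  assumes "bilinear_over s1 s2 s3 f"
  shows bilinear_over_right: "module_hom s2 s3 (\<lambda>y. f x y)"
    and bilinear_over_left: "module_hom s1 s3 (\<lambda>x. f x y)"
  using assms by (simp_all add: bilinear_over_def Vector_Spaces.linear_def)

lemmas bilinear_over_add_right = module_hom.add[OF bilinear_over_right]
  and bilinear_over_add_left = module_hom.add[OF bilinear_over_left]
  and bilinear_over_diff_right = module_hom.diff[OF bilinear_over_right]
  and bilinear_over_diff_left = module_hom.diff[OF bilinear_over_left]
  and bilinear_over_zero_right = module_hom.zero[OF bilinear_over_right]
  and bilinear_over_zero_left = module_hom.zero[OF bilinear_over_left]
  and bilinear_over_minus_right = module_hom.neg[OF bilinear_over_right]
  and bilinear_over_minus_left = module_hom.neg[OF bilinear_over_left]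
  and bilinear_over_scale_right = module_hom.scale[OF bilinear_over_right]
  and bilinear_over_scale_left = module_hom.scale[OF bilinear_over_left]

lemmas bilinear_over_simps =
  bilinear_over_add_right bilinear_over_add_left bilinear_over_diff_right bilinear_over_diff_left
  bilinear_over_zero_right bilinear_over_zero_left bilinear_over_minus_right
  bilinear_over_minus_left bilinear_over_scale_right bilinear_over_scale_left

text \<open>The associative product is not required to have a unit.\<close>

locale poisson_algebra = vector_space scale
  for scale :: "'k::field \<Rightarrow> 'a::ab_group_add \<Rightarrow> 'a" +
  fixes mult :: "'a \<Rightarrow> 'a \<Rightarrow> 'a"
    and bracket :: "'a \<Rightarrow> 'a \<Rightarrow> 'a"
  assumes mult_bilinear: "bilinear_over scale scale scale mult"
    and mult_assoc: "mult (mult x y) z = mult x (mult y z)"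
    and mult_commute: "mult x y = mult y x"
    and bracket_bilinear: "bilinear_over scale scale scale bracket"
    and bracket_self: "bracket x x = 0"
    and jacobi: "bracket x (bracket y z) + bracket y (bracket z x) + bracket z (bracket x y) = 0"
    and leibniz: "bracket x (mult y z) = mult (bracket x y) z + mult y (bracket x z)"
begin

lemma bracket_skew: "bracket x y = - bracket y x"
proof -
  have "bracket (x + y) (x + y) = bracket x y + bracket y x"
    using bracket_self[of x] bracket_self[of y]
    by (simp add: bilinear_over_add_left[OF bracket_bilinear]
        bilinear_over_add_right[OF bracket_bilinear])
  then show ?thesis
    by (simp add: bracket_self eq_neg_iff_add_eq_0)
qed

definition poisson_subalgebra :: "'a set \<Rightarrow> bool"
  where "poisson_subalgebra S \<longleftrightarrow>
    subspace S \<and> (\<forall>x\<in>S. \<forall>y\<in>S. mult x y \<in> S) \<and> (\<forall>x\<in>S. \<forall>y\<in>S. bracket x y \<in> S)"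

end

locale proto_twilled_poisson_algebra = poisson_algebra scale mult bracket
  for scale :: "'k::field \<Rightarrow> 'a::ab_group_add \<Rightarrow> 'a" and mult bracket +
  fixes U V :: "'a set"
  assumes subspace_left: "subspace U"
    and subspace_right: "subspace V"
    and direct: "U \<inter> V = {0}"
    and decomposition: "{u + v | u v. u \<in> U \<and> v \<in> V} = UNIV"

text \<open>Linear maps \<open>P\<^sub>1 \<rightarrow> End(P\<^sub>2)\<close> are given in uncurried form, as bilinear maps
  \<open>P\<^sub>1 \<times> P\<^sub>2 \<rightarrow> P\<^sub>2\<close>.\<close>

locale poisson_action =
  P1: poisson_algebra scale1 mult1 bracket1 + P2: poisson_algebra scale2 mult2 bracket2
  for scale1 :: "'k::field \<Rightarrow> 'a::ab_group_add \<Rightarrow> 'a"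
    and mult1 :: "'a \<Rightarrow> 'a \<Rightarrow> 'a" (infixl \<open>\<cdot>\<^sub>1\<close> 70)
    and bracket1 :: "'a \<Rightarrow> 'a \<Rightarrow> 'a" (\<open>\<lbrace>_, _\<rbrace>\<^sub>1\<close>)
    and scale2 :: "'k \<Rightarrow> 'b::ab_group_add \<Rightarrow> 'b"
    and mult2 :: "'b \<Rightarrow> 'b \<Rightarrow> 'b" (infixl \<open>\<cdot>\<^sub>2\<close> 70)
    and bracket2 :: "'b \<Rightarrow> 'b \<Rightarrow> 'b" (\<open>\<lbrace>_, _\<rbrace>\<^sub>2\<close>) +
  fixes \<mu> :: "'a \<Rightarrow> 'b \<Rightarrow> 'b" and \<rho> :: "'a \<Rightarrow> 'b \<Rightarrow> 'b"
  assumes \<mu>_bilinear: "bilinear_over scale1 scale2 scale2 \<mu>"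
    and \<rho>_bilinear: "bilinear_over scale1 scale2 scale2 \<rho>"
    and \<mu>_mult: "\<mu> (x \<cdot>\<^sub>1 y) u = \<mu> x (\<mu> y u)"
    and \<rho>_bracket: "\<rho> (\<lbrace>x, y\<rbrace>\<^sub>1) u = \<rho> x (\<rho> y u) - \<rho> y (\<rho> x u)"
    and \<mu>_bracket: "\<mu> (\<lbrace>x, y\<rbrace>\<^sub>1) u = \<rho> x (\<mu> y u) - \<mu> y (\<rho> x u)"
    and \<rho>_mult: "\<rho> (x \<cdot>\<^sub>1 y) u = \<mu> x (\<rho> y u) + \<mu> y (\<rho> x u)"
    and \<mu>_mult2: "\<mu> x (u \<cdot>\<^sub>2 v) = \<mu> x u \<cdot>\<^sub>2 v"
    and \<mu>_bracket2: "\<mu> x (\<lbrace>u, v\<rbrace>\<^sub>2) = \<lbrace>\<mu> x u, v\<rbrace>\<^sub>2 - u \<cdot>\<^sub>2 \<rho> x v"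
    and \<rho>_mult2: "\<rho> x (u \<cdot>\<^sub>2 v) = \<rho> x u \<cdot>\<^sub>2 v + u \<cdot>\<^sub>2 \<rho> x v"
    and \<rho>_bracket2: "\<rho> x (\<lbrace>u, v\<rbrace>\<^sub>2) = \<lbrace>\<rho> x u, v\<rbrace>\<^sub>2 + \<lbrace>u, \<rho> x v\<rbrace>\<^sub>2"
begin

sublocale sum: vector_space_prod scale2 scale1
  by unfold_locales

definition semidirect_mult :: "'b \<times> 'a \<Rightarrow> 'b \<times> 'a \<Rightarrow> 'b \<times> 'a"
  where "semidirect_mult = (\<lambda>(u, x) (v, y). (u \<cdot>\<^sub>2 v + \<mu> x v + \<mu> y u, x \<cdot>\<^sub>1 y))"

definition semidirect_bracket :: "'b \<times> 'a \<Rightarrow> 'b \<times> 'a \<Rightarrow> 'b \<times> 'a"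
  where "semidirect_bracket = (\<lambda>(u, x) (v, y). (\<lbrace>u, v\<rbrace>\<^sub>2 + \<rho> x v - \<rho> y u, \<lbrace>x, y\<rbrace>\<^sub>1))"

lemmas action_bilinear_simps =
  bilinear_over_simps[OF P1.mult_bilinear] bilinear_over_simps[OF P1.bracket_bilinear]
  bilinear_over_simps[OF P2.mult_bilinear] bilinear_over_simps[OF P2.bracket_bilinear]
  bilinear_over_simps[OF \<mu>_bilinear] bilinear_over_simps[OF \<rho>_bilinear]

lemma \<mu>_mult2_right: "u \<cdot>\<^sub>2 \<mu> x v = \<mu> x u \<cdot>\<^sub>2 v"
  by (metis P2.mult_commute \<mu>_mult2)

lemma \<mu>_bracket2_left: "\<lbrace>\<mu> x u, v\<rbrace>\<^sub>2 = \<mu> x (\<lbrace>u, v\<rbrace>\<^sub>2) + u \<cdot>\<^sub>2 \<rho> x v"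
  by (simp add: \<mu>_bracket2)

lemma \<mu>_bracket2_right: "\<lbrace>u, \<mu> x v\<rbrace>\<^sub>2 = \<mu> x (\<lbrace>u, v\<rbrace>\<^sub>2) - v \<cdot>\<^sub>2 \<rho> x u"
  using \<mu>_bracket2_left[of x v u] P2.bracket_skew[of u "\<mu> x v"] P2.bracket_skew[of u v]
  by (simp add: action_bilinear_simps)

lemma \<mu>_commute: "\<mu> x (\<mu> y u) = \<mu> y (\<mu> x u)"
  by (metis P1.mult_commute \<mu>_mult)

sublocale semidirect: proto_twilled_poisson_algebra sum.scale semidirect_mult semidirect_bracket
  "UNIV \<times> {0}" "{0} \<times> UNIV"
proof
  show "bilinear_over sum.scale sum.scale sum.scale semidirect_mult"
    by (rule bilinear_overI; (unfold_locales)?)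
      (auto simp: semidirect_mult_def sum.scale_def action_bilinear_simps algebra_simps
        split: prod.splits)
  show "bilinear_over sum.scale sum.scale sum.scale semidirect_bracket"
    by (rule bilinear_overI; (unfold_locales)?)
      (auto simp: semidirect_bracket_def sum.scale_def action_bilinear_simps algebra_simps
        split: prod.splits)
next
  fix p q r :: "'b \<times> 'a"
  obtain u x v y w z where [simp]: "p = (u, x)" "q = (v, y)" "r = (w, z)"
    by (metis surj_pair)
  show "semidirect_mult (semidirect_mult p q) r = semidirect_mult p (semidirect_mult q r)"
    using \<mu>_commute[of z x v] \<mu>_commute[of z y u]
    by (simp add: semidirect_mult_def action_bilinear_simps P1.mult_assoc P2.mult_assoc \<mu>_mult
        \<mu>_mult2 \<mu>_mult2_right)
  show "semidirect_mult p q = semidirect_mult q p"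
    using P1.mult_commute P2.mult_commute by (simp add: semidirect_mult_def)
  show "semidirect_bracket p p = 0"
    by (simp add: semidirect_bracket_def P1.bracket_self P2.bracket_self zero_prod_def)
  have "\<lbrace>u, \<lbrace>v, w\<rbrace>\<^sub>2 + \<rho> y w - \<rho> z v\<rbrace>\<^sub>2 + \<rho> x (\<lbrace>v, w\<rbrace>\<^sub>2 + \<rho> y w - \<rho> z v) - \<rho> (\<lbrace>y, z\<rbrace>\<^sub>1) u
    + (\<lbrace>v, \<lbrace>w, u\<rbrace>\<^sub>2 + \<rho> z u - \<rho> x w\<rbrace>\<^sub>2 + \<rho> y (\<lbrace>w, u\<rbrace>\<^sub>2 + \<rho> z u - \<rho> x w) - \<rho> (\<lbrace>z, x\<rbrace>\<^sub>1) v)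
    + (\<lbrace>w, \<lbrace>u, v\<rbrace>\<^sub>2 + \<rho> x v - \<rho> y u\<rbrace>\<^sub>2 + \<rho> z (\<lbrace>u, v\<rbrace>\<^sub>2 + \<rho> x v - \<rho> y u) - \<rho> (\<lbrace>x, y\<rbrace>\<^sub>1) w)
    = \<lbrace>u, \<lbrace>v, w\<rbrace>\<^sub>2\<rbrace>\<^sub>2 + \<lbrace>v, \<lbrace>w, u\<rbrace>\<^sub>2\<rbrace>\<^sub>2 + \<lbrace>w, \<lbrace>u, v\<rbrace>\<^sub>2\<rbrace>\<^sub>2"
    using P2.bracket_skew[of "\<rho> x v" w] P2.bracket_skew[of "\<rho> y w" u] P2.bracket_skew[of "\<rho> z u" v]
      P2.bracket_skew[of "\<rho> x w" v] P2.bracket_skew[of "\<rho> y u" w] P2.bracket_skew[of "\<rho> z v" u]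
    by (simp add: action_bilinear_simps \<rho>_bracket \<rho>_bracket2 algebra_simps)
  then show "semidirect_bracket p (semidirect_bracket q r)
      + semidirect_bracket q (semidirect_bracket r p)
      + semidirect_bracket r (semidirect_bracket p q) = 0"
    by (simp add: semidirect_bracket_def P1.jacobi P2.jacobi zero_prod_def)
  have mixed: "\<mu> y (\<rho> x w) + \<mu> (\<lbrace>x, y\<rbrace>\<^sub>1) w = \<rho> x (\<mu> y w)" for x y w
    by (simp add: \<mu>_bracket)
  show "semidirect_bracket p (semidirect_mult q r)
      = semidirect_mult (semidirect_bracket p q) r + semidirect_mult q (semidirect_bracket p r)"
    using mixed[of y x w] mixed[of z x v] P2.mult_commute[of w "\<rho> y u"]
    by (simp add: semidirect_bracket_def semidirect_mult_def action_bilinear_simps P1.leibniz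
        P2.leibniz \<rho>_mult \<rho>_mult2 \<mu>_bracket \<mu>_bracket2_right algebra_simps)
next
  show "sum.p.subspace (UNIV \<times> {0})"
    by (auto simp: sum.p.subspace_def sum.scale_def zero_prod_def)
  show "sum.p.subspace ({0} \<times> UNIV)"
    by (auto simp: sum.p.subspace_def sum.scale_def zero_prod_def)
  show "UNIV \<times> {0} \<inter> {0} \<times> UNIV = {0 :: 'b \<times> 'a}"
    by (auto simp: zero_prod_def)
  have "p \<in> {a + b | a b. a \<in> UNIV \<times> {0} \<and> b \<in> {0} \<times> UNIV}" for p :: "'b \<times> 'a"
    by (cases p) force
  then show "{a + b | a b. a \<in> UNIV \<times> {0} \<and> b \<in> {0} \<times> UNIV} = (UNIV :: ('b \<times> 'a) set)"
    by blast
qed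

definition relative_crossed_hom :: "('a \<Rightarrow> 'b) \<Rightarrow> bool"
  where "relative_crossed_hom D \<longleftrightarrow> Vector_Spaces.linear scale1 scale2 D \<and>
    (\<forall>x y. D (x \<cdot>\<^sub>1 y) = \<mu> x (D y) + \<mu> y (D x) + D x \<cdot>\<^sub>2 D y) \<and>
    (\<forall>x y. D (\<lbrace>x, y\<rbrace>\<^sub>1) = \<rho> x (D y) - \<rho> y (D x) + \<lbrace>D x, D y\<rbrace>\<^sub>2)"

end

definition Gr :: "('a \<Rightarrow> 'b) \<Rightarrow> ('b \<times> 'a) set"
  where "Gr D = {(D x, x) | x. True}"

end

theory Submission
  imports Defs
begin

text \<open>The semidirect product of \<open>(D x, x)\<close> and \<open>(D y, y)\<close> has second
  component \<open>x \<cdot>\<^sub>1 y\<close>, and its first component is the right-hand side of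
  the product identity for \<open>D\<close>. By \<open>mem_Gr_iff\<close> it lies in
  \<open>Gr D\<close> exactly when that identity holds at \<open>x\<close>, \<open>y\<close>;
  brackets behave the same way. Linearity of \<open>D\<close> supplies the subspace condition
  (\<open>subspace_Gr\<close>).\<close>

lemma mem_Gr_iff: "(v, x) \<in> Gr D \<longleftrightarrow> D x = v"
  by (auto simp: Gr_def)

text \<open>Parametrizing the graph by \<open>x\<close> turns the closure conditions into statements
  quantified like the crossed homomorphism identities.\<close>

lemma ball_Gr_iff: "(\<forall>p\<in>Gr D. P p) \<longleftrightarrow> (\<forall>x. P (D x, x))"
  by (auto simp: Gr_def)

context poisson_action
begin

lemma subspace_Gr:
  assumes "Vector_Spaces.linear scale1 scale2 D"
  shows "sum.p.subspace (Gr D)"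
proof -
  interpret D: Vector_Spaces.linear scale1 scale2 D by fact
  show ?thesis
    by (auto simp: sum.p.subspace_def sum.scale_def zero_prod_def mem_Gr_iff D.zero D.add D.scale)
qed

lemma relative_crossed_hom_iff_poisson_subalgebra_Gr:
  assumes "Vector_Spaces.linear scale1 scale2 D"
  shows "relative_crossed_hom D \<longleftrightarrow> semidirect.poisson_subalgebra (Gr D)"
  using assms subspace_Gr[OF assms]
  unfolding relative_crossed_hom_def semidirect.poisson_subalgebra_def ball_Gr_iff
  \<comment> \<open>The two sides now differ only in the order of summands: the term internal to the
    second algebra comes first in the semidirect operations and last in
    \<open>relative_crossed_hom\<close>.\<close>
  by (simp add: mem_Gr_iff semidirect_mult_def semidirect_bracket_def
      algebra_simps)

end

theorem proposition5p17:
  fixes scale1 :: "'k::field_char_0 \<Rightarrow> 'a::ab_group_add \<Rightarrow> 'a"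
    and mult1 bracket1 :: "'a \<Rightarrow> 'a \<Rightarrow> 'a"
    and scale2 :: "'k \<Rightarrow> 'b::ab_group_add \<Rightarrow> 'b"
    and mult2 bracket2 :: "'b \<Rightarrow> 'b \<Rightarrow> 'b"
    and \<mu> \<rho> :: "'a \<Rightarrow> 'b \<Rightarrow> 'b"
    and D :: "'a \<Rightarrow> 'b"
  assumes "poisson_action scale1 mult1 bracket1 scale2 mult2 bracket2 \<mu> \<rho>"
    and "Vector_Spaces.linear scale1 scale2 D"
  shows "poisson_action.relative_crossed_hom scale1 mult1 bracket1 scale2 mult2 bracket2 \<mu> \<rho> D \<longleftrightarrow>
    poisson_algebra.poisson_subalgebra (module_prod.scale scale2 scale1)
      (poisson_action.semidirect_mult mult1 mult2 \<mu>)
      (poisson_action.semidirect_bracket bracket1 bracket2 \<rho>)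
      (Gr D)"
  using assms by (rule poisson_action.relative_crossed_hom_iff_poisson_subalgebra_Gr)

end
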